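(* Let $\Gamma$ be a nontrivial additive subgroup of $\mathbb{C}$ and $HV=HV(\Gamma)$. Then $H^2(HV,\mathbb{C})=0$.
   Context: $\mathbb{Z}_+$ denotes the nonnegative integers. For a nontrivial additive subgroup $\Gamma$ of $\mathbb{C}$, $HV=HV(\Gamma)$ is the complex Lie algebra with basis $\{L_{\alpha,i},H_{\alpha,i}\mid\alpha\in\Gamma,\ i\in\mathbb{Z}_+\}$ and brackets $$[L_{\alpha,i},L_{\beta,j}]=(\beta-\alpha)L_{\alpha+\beta,i+j}+(j-i)L_{\alpha+\beta,i+j-1},$$ $$[L_{\alpha,i},H_{\beta,j}]=\beta H_{\alpha+\beta,i+j}+jH_{\alpha+\beta,i+j-1},\qquad [H_{\alpha,i},H_{\beta,j}]=0,$$ where terms with second index $-1$ have coefficient $0$ and are read as $0$. A 2-cocycle on $HV$ is a bilinear form $\psi:HV\times HV\to\mathbb{C}$ with $\psi(x,y)=-\psi(y,x)$ and $\psi(x,[y,z])+\psi(y,[z,x])+\psi(z,[x,y])=0$ for all $x,y,z\in HV$; $C^2(HV,\mathbb{C})$ is the space of 2-cocycles. For a linear function $f:HV\to\mathbb{C}$, $\psi_f(x,y)=f([x,y])$ is a 2-cocycle, called a 2-coboundary; $B^2(HV,\mathbb{C})$ is the space of 2-coboundaries. $H^2(HV,\mathbb{C})=C^2(HV,\mathbb{C})/B^2(HV,\mathbb{C})$. *)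

theory Defs
  imports Complex_Main "HOL-Library.Poly_Mapping"
begin

definition complex_subgroup :: "complex set \<Rightarrow> bool" where
  "complex_subgroup \<Gamma> \<longleftrightarrow>
     0 \<in> \<Gamma> \<and> (\<forall>\<alpha>\<in>\<Gamma>. \<forall>\<beta>\<in>\<Gamma>. \<alpha> + \<beta> \<in> \<Gamma>) \<and> (\<forall>\<alpha>\<in>\<Gamma>. - \<alpha> \<in> \<Gamma>)"

subsection \<open>The Lie algebra \<open>HV(\<Gamma>)\<close>\<close>

text \<open>
  The subgroup \<open>\<Gamma>\<close> is a set, not a type, so everything lives in the free complex vector space
  on all symbols \<open>L\<^bsub>\<alpha>,i\<^esub>\<close>, \<open>H\<^bsub>\<alpha>,i\<^esub>\<close> with \<open>\<alpha> \<in> \<complex>\<close> (finitely supported coefficient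
  functions), and \<open>HV \<Gamma>\<close> is the subspace of vectors supported on the symbols with
  \<open>\<alpha> \<in> \<Gamma>\<close>.
\<close>

datatype hv_index = L_idx complex nat | H_idx complex nat

type_synonym hv = "hv_index \<Rightarrow>\<^sub>0 complex"

definition scale_hv :: "complex \<Rightarrow> hv \<Rightarrow> hv" where
  "scale_hv c x = Poly_Mapping.map ((*) c) x"

definition HV_basis :: "complex set \<Rightarrow> hv_index set" where
  "HV_basis \<Gamma> = {L_idx \<alpha> i | \<alpha> i. \<alpha> \<in> \<Gamma>} \<union> {H_idx \<alpha> i | \<alpha> i. \<alpha> \<in> \<Gamma>}"

definition HV :: "complex set \<Rightarrow> hv set" where
  "HV \<Gamma> = {x. Poly_Mapping.keys x \<subseteq> HV_basis \<Gamma>}"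

text \<open>
  The brackets of basis vectors; \<open>Poly_Mapping.single k c\<close> is \<open>c\<close> times the basis vector
  \<open>k\<close>. The subtraction in \<open>i + j - 1\<close> is truncated, but it only truncates when
  \<open>i = j = 0\<close>, and then the coefficient of that term is \<open>0\<close>.
  The bracket of an \<open>H\<close> with an \<open>L\<close> is fixed by skew-symmetry.
\<close>

fun basis_bracket :: "hv_index \<Rightarrow> hv_index \<Rightarrow> hv" where
  "basis_bracket (L_idx \<alpha> i) (L_idx \<beta> j) =
     Poly_Mapping.single (L_idx (\<alpha> + \<beta>) (i + j)) (\<beta> - \<alpha>)
     + Poly_Mapping.single (L_idx (\<alpha> + \<beta>) (i + j - 1)) (of_nat j - of_nat i)"
| "basis_bracket (L_idx \<alpha> i) (H_idx \<beta> j) =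
     Poly_Mapping.single (H_idx (\<alpha> + \<beta>) (i + j)) \<beta>
     + Poly_Mapping.single (H_idx (\<alpha> + \<beta>) (i + j - 1)) (of_nat j)"
| "basis_bracket (H_idx \<alpha> i) (L_idx \<beta> j) =
     - (Poly_Mapping.single (H_idx (\<beta> + \<alpha>) (j + i)) \<alpha>
        + Poly_Mapping.single (H_idx (\<beta> + \<alpha>) (j + i - 1)) (of_nat i))"
| "basis_bracket (H_idx \<alpha> i) (H_idx \<beta> j) = 0"

definition bracket :: "hv \<Rightarrow> hv \<Rightarrow> hv" where
  "bracket x y =
     (\<Sum>a\<in>Poly_Mapping.keys x. \<Sum>b\<in>Poly_Mapping.keys y.
        scale_hv (Poly_Mapping.lookup x a * Poly_Mapping.lookup y b) (basis_bracket a b))"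

text \<open>
  That \<open>HV \<Gamma>\<close> is closed under this bracket, with the given basis vectors spanning it, and that
  the bracket is bilinear and satisfies skew-symmetry and the Jacobi identity, is proved below.
\<close>

lemma lookup_scale_hv [simp]:
  "Poly_Mapping.lookup (scale_hv c x) k = c * Poly_Mapping.lookup x k"
  by (simp add: scale_hv_def map.rep_eq when_def)

interpretation hv: vector_space scale_hv
  by unfold_locales (auto intro!: poly_mapping_eqI simp: lookup_add algebra_simps)

lemma scale_hv_single [simp]: "scale_hv c (Poly_Mapping.single k d) = Poly_Mapping.single k (c * d)"
  by (auto intro!: poly_mapping_eqI simp: lookup_single when_def)

lemma bracket_superset:
  assumes "finite A" "finite B" "Poly_Mapping.keys x \<subseteq> A" "Poly_Mapping.keys y \<subseteq> B"
  shows "bracket x y = (\<Sum>a\<in>A. \<Sum>b\<in>B.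
           scale_hv (Poly_Mapping.lookup x a * Poly_Mapping.lookup y b) (basis_bracket a b))"
proof -
  have "(\<Sum>a\<in>Poly_Mapping.keys x. \<Sum>b\<in>Poly_Mapping.keys y.
           scale_hv (Poly_Mapping.lookup x a * Poly_Mapping.lookup y b) (basis_bracket a b))
      = (\<Sum>a\<in>Poly_Mapping.keys x. \<Sum>b\<in>B.
           scale_hv (Poly_Mapping.lookup x a * Poly_Mapping.lookup y b) (basis_bracket a b))"
    using assms by (intro sum.cong sum.mono_neutral_left refl) (auto simp: in_keys_iff)
  also have "\<dots> = (\<Sum>a\<in>A. \<Sum>b\<in>B.
           scale_hv (Poly_Mapping.lookup x a * Poly_Mapping.lookup y b) (basis_bracket a b))"
    using assms by (intro sum.mono_neutral_left) (auto simp: in_keys_iff)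
  finally show ?thesis by (simp add: bracket_def)
qed

lemma bracket_single:
  "bracket (Poly_Mapping.single a c) (Poly_Mapping.single b d) = scale_hv (c * d) (basis_bracket a b)"
  by (subst bracket_superset[of "{a}" "{b}"]) (auto simp: keys_single)

lemma bracket_add_left: "bracket (x + x') y = bracket x y + bracket x' y"
proof -
  let ?A = "Poly_Mapping.keys x \<union> Poly_Mapping.keys x'"
  have "Poly_Mapping.keys (x + x') \<subseteq> ?A" by (rule keys_add)
  then show ?thesis
    by (simp add: bracket_superset[of ?A "Poly_Mapping.keys y"] lookup_add distrib_right
        hv.scale_left_distrib sum.distrib)
qed

lemma bracket_add_right: "bracket x (y + y') = bracket x y + bracket x y'"
proof -
  let ?B = "Poly_Mapping.keys y \<union> Poly_Mapping.keys y'"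
  have "Poly_Mapping.keys (y + y') \<subseteq> ?B" by (rule keys_add)
  then show ?thesis
    by (simp add: bracket_superset[of "Poly_Mapping.keys x" ?B] lookup_add distrib_left
        hv.scale_left_distrib sum.distrib)
qed

lemma keys_scale_hv: "Poly_Mapping.keys (scale_hv c x) \<subseteq> Poly_Mapping.keys x"
  by (auto simp: in_keys_iff)

lemma bracket_scale_left: "bracket (scale_hv c x) y = scale_hv c (bracket x y)"
  using keys_scale_hv[of c x]
  by (simp add: bracket_superset[of "Poly_Mapping.keys x" "Poly_Mapping.keys y"]
      hv.scale_sum_right mult.assoc)

lemma bracket_scale_right: "bracket x (scale_hv c y) = scale_hv c (bracket x y)"
  using keys_scale_hv[of c y]
  by (simp add: bracket_superset[of "Poly_Mapping.keys x" "Poly_Mapping.keys y"]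
      hv.scale_sum_right mult_ac)

lemma bracket_zero [simp]: "bracket 0 y = 0" "bracket x 0 = 0"
  by (simp_all add: bracket_def)

lemma bracket_minus_right: "bracket x (- y) = - bracket x y"
  by (metis add.right_inverse bracket_add_right bracket_zero(2) eq_neg_iff_add_eq_0)

lemma bracket_diff_right: "bracket x (y - z) = bracket x y - bracket x z"
  using bracket_add_right[of x y "- z"] by (simp add: bracket_minus_right)

lemma basis_bracket_skew: "basis_bracket a b = - basis_bracket b a"
  by (cases a; cases b) (simp_all add: add.commute single_uminus [symmetric] del: single_uminus)

lemma bracket_skew: "bracket x y = - bracket y x"
proof -
  have "bracket x y = (\<Sum>b\<in>Poly_Mapping.keys y. \<Sum>a\<in>Poly_Mapping.keys x.
          scale_hv (Poly_Mapping.lookup x a * Poly_Mapping.lookup y b) (basis_bracket a b))"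
    unfolding bracket_def by (rule sum.swap)
  also have "\<dots> = - bracket y x"
    unfolding bracket_def sum_negf [symmetric] hv.scale_minus_right [symmetric]
    by (intro sum.cong refl) (simp add: basis_bracket_skew [symmetric] mult.commute)
  finally show ?thesis .
qed

lemma hv_induct [case_names single add]:
  fixes x :: hv
  assumes "\<And>k c. P (Poly_Mapping.single k c)" "\<And>x y. P x \<Longrightarrow> P y \<Longrightarrow> P (x + y)"
  shows "P x"
proof (induction x rule: update_induct)
  case const
  then show ?case using assms(1)[of undefined 0] by simp
next
  case (update f a b)
  have "Poly_Mapping.update a b f = f + Poly_Mapping.single a b"
    using update by (intro poly_mapping_eqI)
      (auto simp: lookup_update lookup_add lookup_single in_keys_iff when_def)
  then show ?case using assms update by metis
qed

lemma bracket_L_L: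
  "bracket (Poly_Mapping.single (L_idx \<alpha> i) r) (Poly_Mapping.single (L_idx \<beta> j) s) =
     Poly_Mapping.single (L_idx (\<alpha> + \<beta>) (i + j)) (r * s * (\<beta> - \<alpha>)) +
     Poly_Mapping.single (L_idx (\<alpha> + \<beta>) (i + j - 1)) (r * s * (of_nat j - of_nat i))"
  by (simp add: bracket_single hv.scale_right_distrib)

lemma bracket_L_H:
  "bracket (Poly_Mapping.single (L_idx \<alpha> i) r) (Poly_Mapping.single (H_idx \<beta> j) s) =
     Poly_Mapping.single (H_idx (\<alpha> + \<beta>) (i + j)) (r * s * \<beta>) +
     Poly_Mapping.single (H_idx (\<alpha> + \<beta>) (i + j - 1)) (r * s * of_nat j)"
  by (simp add: bracket_single hv.scale_right_distrib)

lemma bracket_pred: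
  assumes "m = 0 \<longrightarrow> c = 0"
  shows "bracket (Poly_Mapping.single (L_idx \<alpha> i) r) (Poly_Mapping.single (L_idx \<beta> (m - 1)) c) =
      Poly_Mapping.single (L_idx (\<alpha> + \<beta>) (i + m - 1)) (r * c * (\<beta> - \<alpha>)) +
      Poly_Mapping.single (L_idx (\<alpha> + \<beta>) (i + m - 2)) (r * c * (of_nat m - 1 - of_nat i))"
    and "bracket (Poly_Mapping.single (L_idx \<alpha> i) r) (Poly_Mapping.single (H_idx \<beta> (m - 1)) c) =
      Poly_Mapping.single (H_idx (\<alpha> + \<beta>) (i + m - 1)) (r * c * \<beta>) +
      Poly_Mapping.single (H_idx (\<alpha> + \<beta>) (i + m - 2)) (r * c * (of_nat m - 1))"
    and "bracket (Poly_Mapping.single (L_idx \<alpha> (m - 1)) c) (Poly_Mapping.single (H_idx \<beta> i) r) =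
      Poly_Mapping.single (H_idx (\<alpha> + \<beta>) (m + i - 1)) (c * r * \<beta>) +
      Poly_Mapping.single (H_idx (\<alpha> + \<beta>) (m + i - 2)) (c * r * of_nat i)"
  using assms by (cases m; simp add: bracket_L_L bracket_L_H numeral_2_eq_2)+

lemma merge_singles:
  fixes a b b' c :: complex
  assumes "A = A'" "B = B''" "B' = B''" "C = C'" "a = a'" "b + b' = b''" "c = c'"
  shows "Poly_Mapping.single A a + Poly_Mapping.single B b +
           (Poly_Mapping.single B' b' + Poly_Mapping.single C c) =
         Poly_Mapping.single A' a' + Poly_Mapping.single B'' b'' + Poly_Mapping.single C' c'"
  using assms(1-5,7) by (simp add: assms(6) [symmetric] single_add add_ac)

lemma bracket_L_LL:
  "bracket (Poly_Mapping.single (L_idx \<alpha> i) r)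
     (bracket (Poly_Mapping.single (L_idx \<beta> j) s) (Poly_Mapping.single (L_idx \<gamma> l) t)) =
   Poly_Mapping.single (L_idx (\<alpha> + \<beta> + \<gamma>) (i + j + l)) (r * s * t * ((\<gamma> - \<beta>) * (\<beta> + \<gamma> - \<alpha>))) +
   Poly_Mapping.single (L_idx (\<alpha> + \<beta> + \<gamma>) (i + j + l - 1))
     (r * s * t * ((\<gamma> - \<beta>) * (of_nat j + of_nat l - of_nat i) + (of_nat l - of_nat j) * (\<beta> + \<gamma> - \<alpha>))) +
   Poly_Mapping.single (L_idx (\<alpha> + \<beta> + \<gamma>) (i + j + l - 2))
     (r * s * t * ((of_nat l - of_nat j) * (of_nat j + of_nat l - 1 - of_nat i)))"
proof -
  have c: "j + l = 0 \<longrightarrow> s * t * (of_nat l - of_nat j) = (0::complex)" by simp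
  note pred = bracket_pred(1)[where m = "j + l" and c = "s * t * (of_nat l - of_nat j)", OF c]
  show ?thesis
    unfolding bracket_L_L[of \<beta> j s] bracket_add_right pred
    unfolding bracket_L_L
    by (rule merge_singles) (simp_all add: algebra_simps)
qed

lemma bracket_L_LH:
  "bracket (Poly_Mapping.single (L_idx \<alpha> i) r)
     (bracket (Poly_Mapping.single (L_idx \<beta> j) s) (Poly_Mapping.single (H_idx \<gamma> l) t)) =
   Poly_Mapping.single (H_idx (\<alpha> + \<beta> + \<gamma>) (i + j + l)) (r * s * t * (\<gamma> * (\<beta> + \<gamma>))) +
   Poly_Mapping.single (H_idx (\<alpha> + \<beta> + \<gamma>) (i + j + l - 1))
     (r * s * t * (\<gamma> * (of_nat j + of_nat l) + of_nat l * (\<beta> + \<gamma>))) +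
   Poly_Mapping.single (H_idx (\<alpha> + \<beta> + \<gamma>) (i + j + l - 2))
     (r * s * t * (of_nat l * (of_nat j + of_nat l - 1)))"
proof -
  have c: "j + l = 0 \<longrightarrow> s * t * of_nat l = (0::complex)" by simp
  note pred = bracket_pred(2)[where m = "j + l" and c = "s * t * of_nat l", OF c]
  show ?thesis
    unfolding bracket_L_H[of \<beta> j s] bracket_add_right pred
    unfolding bracket_L_H
    by (rule merge_singles) (simp_all add: algebra_simps)
qed

lemma bracket_LL_H:
  "bracket (bracket (Poly_Mapping.single (L_idx \<alpha> i) r) (Poly_Mapping.single (L_idx \<beta> j) s))
     (Poly_Mapping.single (H_idx \<gamma> l) t) =
   Poly_Mapping.single (H_idx (\<alpha> + \<beta> + \<gamma>) (i + j + l)) (r * s * t * ((\<beta> - \<alpha>) * \<gamma>)) +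
   Poly_Mapping.single (H_idx (\<alpha> + \<beta> + \<gamma>) (i + j + l - 1))
     (r * s * t * ((\<beta> - \<alpha>) * of_nat l + (of_nat j - of_nat i) * \<gamma>)) +
   Poly_Mapping.single (H_idx (\<alpha> + \<beta> + \<gamma>) (i + j + l - 2))
     (r * s * t * ((of_nat j - of_nat i) * of_nat l))"
proof -
  have c: "i + j = 0 \<longrightarrow> r * s * (of_nat j - of_nat i) = (0::complex)" by simp
  note pred = bracket_pred(3)[where m = "i + j" and c = "r * s * (of_nat j - of_nat i)", OF c]
  show ?thesis
    unfolding bracket_L_L[of \<alpha> i r] bracket_add_left pred
    unfolding bracket_L_H
    by (rule merge_singles) (simp_all add: algebra_simps)
qed

lemma sum_singles_eq_0:
  fixes a1 a2 a3 :: complex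
  assumes "a1 + a2 + a3 = 0" "b1 + b2 + b3 = 0" "c1 + c2 + c3 = 0"
  shows "(Poly_Mapping.single A a1 + Poly_Mapping.single B b1 + Poly_Mapping.single C c1) +
         (Poly_Mapping.single A a2 + Poly_Mapping.single B b2 + Poly_Mapping.single C c2) +
         (Poly_Mapping.single A a3 + Poly_Mapping.single B b3 + Poly_Mapping.single C c3) = 0"
  (is "?l = 0")
proof -
  have "?l = Poly_Mapping.single A (a1 + a2 + a3) + Poly_Mapping.single B (b1 + b2 + b3)
           + Poly_Mapping.single C (c1 + c2 + c3)"
    by (simp add: single_add add_ac)
  then show ?thesis using assms by simp
qed

lemma jacobi_basis_LLL:
  fixes e defines "e \<equiv> Poly_Mapping.single"
  shows "bracket (e (L_idx \<alpha> i) r) (bracket (e (L_idx \<beta> j) s) (e (L_idx \<gamma> l) t))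
       + bracket (e (L_idx \<beta> j) s) (bracket (e (L_idx \<gamma> l) t) (e (L_idx \<alpha> i) r))
       + bracket (e (L_idx \<gamma> l) t) (bracket (e (L_idx \<alpha> i) r) (e (L_idx \<beta> j) s)) = 0"
proof -
  have "\<beta> + \<gamma> + \<alpha> = \<alpha> + \<beta> + \<gamma>" "\<gamma> + \<alpha> + \<beta> = \<alpha> + \<beta> + \<gamma>"
    "j + l + i = i + j + l" "l + i + j = i + j + l"
    by simp_all
  then show ?thesis
    unfolding e_def bracket_L_LL by (simp only:) (rule sum_singles_eq_0; simp add: algebra_simps)
qed

lemma jacobi_basis_LLH:
  fixes e defines "e \<equiv> Poly_Mapping.single"
  shows "bracket (e (L_idx \<alpha> i) r) (bracket (e (L_idx \<beta> j) s) (e (H_idx \<gamma> l) t))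
       + bracket (e (L_idx \<beta> j) s) (bracket (e (H_idx \<gamma> l) t) (e (L_idx \<alpha> i) r))
       + bracket (e (H_idx \<gamma> l) t) (bracket (e (L_idx \<alpha> i) r) (e (L_idx \<beta> j) s)) = 0"
proof -
  have "\<beta> + \<alpha> + \<gamma> = \<alpha> + \<beta> + \<gamma>" "j + i + l = i + j + l"
    by simp_all
  then show ?thesis
    unfolding e_def bracket_skew[of "Poly_Mapping.single (H_idx \<gamma> l) t"] bracket_minus_right
      bracket_L_LH bracket_LL_H minus_add_distrib single_uminus [symmetric]
    by (simp only:) (rule sum_singles_eq_0; simp add: algebra_simps)
qed

lemma jacobi_basis:
  fixes a b c :: hv_index and r s t :: complex and e
  defines "e \<equiv> Poly_Mapping.single"
  shows "bracket (e a r) (bracket (e b s) (e c t)) + bracket (e b s) (bracket (e c t) (e a r))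
       + bracket (e c t) (bracket (e a r) (e b s)) = 0"
proof -
  define J where "J a r b s c t = bracket (e a r) (bracket (e b s) (e c t))
      + bracket (e b s) (bracket (e c t) (e a r)) + bracket (e c t) (bracket (e a r) (e b s))"
    for a r b s c t
  have rot: "J a r b s c t = J b s c t a r" for a b c r s t
    by (simp add: J_def add_ac)
  have LLL: "J (L_idx \<alpha> i) r (L_idx \<beta> j) s (L_idx \<gamma> l) t = 0" for \<alpha> i r \<beta> j s \<gamma> l t
    unfolding J_def e_def by (rule jacobi_basis_LLL)
  have LLH: "J (L_idx \<alpha> i) r (L_idx \<beta> j) s (H_idx \<gamma> l) t = 0" for \<alpha> i r \<beta> j s \<gamma> l t
    unfolding J_def e_def by (rule jacobi_basis_LLH)
  have LHH: "J k r (H_idx \<beta> j) s (H_idx \<gamma> l) t = 0" for k r \<beta> j s \<gamma> l t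
    unfolding J_def e_def
    by (cases k) (simp_all add: bracket_single bracket_add_right bracket_diff_right bracket_minus_right
        hv.scale_right_distrib hv.scale_right_diff_distrib)
  have "J a r b s c t = 0"
    by (cases a; cases b; cases c; hypsubst)
       (rule LLL LLH LHH | subst rot, rule LLH LHH | subst rot, subst rot, rule LLH LHH)+
  then show ?thesis by (simp add: J_def)
qed

definition jacobiator :: "hv \<Rightarrow> hv \<Rightarrow> hv \<Rightarrow> hv" where
  "jacobiator x y z = bracket x (bracket y z) + bracket y (bracket z x) + bracket z (bracket x y)"

lemma jacobiator_add:
  "jacobiator (x + x') y z = jacobiator x y z + jacobiator x' y z"
  "jacobiator x (y + y') z = jacobiator x y z + jacobiator x y' z"
  "jacobiator x y (z + z') = jacobiator x y z + jacobiator x y z'"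
  by (simp_all add: jacobiator_def bracket_add_left bracket_add_right add_ac)

lemma jacobiator_single:
  "jacobiator (Poly_Mapping.single a r) (Poly_Mapping.single b s) (Poly_Mapping.single c t) = 0"
  unfolding jacobiator_def by (rule jacobi_basis)

lemma jacobiator_eq_0: "jacobiator x y z = 0"
proof -
  have 1: "jacobiator (Poly_Mapping.single a r) (Poly_Mapping.single b s) z = 0" for a b r s z
    by (induction z rule: hv_induct) (simp_all add: jacobiator_single jacobiator_add)
  have 2: "jacobiator (Poly_Mapping.single a r) y z = 0" for a r y z
    by (induction y rule: hv_induct) (simp_all add: 1 jacobiator_add)
  show ?thesis
    by (induction x rule: hv_induct) (simp_all add: 2 jacobiator_add)
qed

lemma subspace_HV: "hv.subspace (HV \<Gamma>)"
  unfolding hv.subspace_def HV_def using keys_add keys_scale_hv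
  by (auto dest!: subsetD[OF keys_add] subsetD[OF keys_scale_hv])

lemma HV_eq_span: "HV \<Gamma> = hv.span ((\<lambda>k. Poly_Mapping.single k 1) ` HV_basis \<Gamma>)"
proof
  show "hv.span ((\<lambda>k. Poly_Mapping.single k 1) ` HV_basis \<Gamma>) \<subseteq> HV \<Gamma>"
    by (intro hv.span_minimal subspace_HV) (auto simp: HV_def)
  show "HV \<Gamma> \<subseteq> hv.span ((\<lambda>k. Poly_Mapping.single k 1) ` HV_basis \<Gamma>)"
  proof
    fix x assume x: "x \<in> HV \<Gamma>"
    have "x = (\<Sum>k\<in>Poly_Mapping.keys x. scale_hv (Poly_Mapping.lookup x k) (Poly_Mapping.single k 1))"
      by (intro poly_mapping_eqI) (auto simp: lookup_sum lookup_single when_def in_keys_iff)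
    also have "\<dots> \<in> hv.span ((\<lambda>k. Poly_Mapping.single k 1) ` HV_basis \<Gamma>)"
      using x by (intro hv.span_sum hv.span_scale hv.span_base) (auto simp: HV_def)
    finally show "x \<in> hv.span ((\<lambda>k. Poly_Mapping.single k 1) ` HV_basis \<Gamma>)" .
  qed
qed

lemma bracket_in_HV:
  assumes "complex_subgroup \<Gamma>" "x \<in> HV \<Gamma>" "y \<in> HV \<Gamma>"
  shows "bracket x y \<in> HV \<Gamma>"
proof -
  have "Poly_Mapping.single k c \<in> HV \<Gamma>" if "k \<in> HV_basis \<Gamma>" for k c
    using that by (simp add: HV_def)
  moreover have "L_idx (\<alpha> + \<beta>) n \<in> HV_basis \<Gamma>" "H_idx (\<alpha> + \<beta>) n \<in> HV_basis \<Gamma>"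
    if "\<alpha> \<in> \<Gamma>" "\<beta> \<in> \<Gamma>" for \<alpha> \<beta> n
    using that assms(1) by (auto simp: HV_basis_def complex_subgroup_def)
  ultimately have "basis_bracket a b \<in> HV \<Gamma>" if "a \<in> HV_basis \<Gamma>" "b \<in> HV_basis \<Gamma>" for a b
    using that
    by (induction a b rule: basis_bracket.induct)
       (simp_all add: HV_basis_def hv.subspace_add[OF subspace_HV] hv.subspace_diff[OF subspace_HV]
          hv.subspace_neg[OF subspace_HV] hv.subspace_0[OF subspace_HV] del: minus_add_distrib)
  then show ?thesis unfolding bracket_def using assms
    by (intro hv.subspace_sum[OF subspace_HV] hv.subspace_scale[OF subspace_HV]) (auto simp: HV_def)
qed

subsection \<open>Second cohomology with trivial coefficients\<close>

definition linear_on_HV :: "complex set \<Rightarrow> (hv \<Rightarrow> complex) \<Rightarrow> bool" where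
  "linear_on_HV \<Gamma> f \<longleftrightarrow>
     (\<forall>x\<in>HV \<Gamma>. \<forall>y\<in>HV \<Gamma>. f (x + y) = f x + f y) \<and>
     (\<forall>c. \<forall>x\<in>HV \<Gamma>. f (scale_hv c x) = c * f x)"

text \<open>
  A form on \<open>HV \<Gamma> \<times> HV \<Gamma>\<close> is represented by the function that is \<open>0\<close> outside
  \<open>HV \<Gamma> \<times> HV \<Gamma>\<close>. This makes the representation unique, so that equality and the pointwise
  operations are those of forms on \<open>HV \<Gamma>\<close>.
\<close>

definition bilinear_form_HV :: "complex set \<Rightarrow> (hv \<Rightarrow> hv \<Rightarrow> complex) \<Rightarrow> bool" where
  "bilinear_form_HV \<Gamma> \<psi> \<longleftrightarrow>
     (\<forall>x\<in>HV \<Gamma>. linear_on_HV \<Gamma> (\<lambda>y. \<psi> x y)) \<and>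
     (\<forall>y\<in>HV \<Gamma>. linear_on_HV \<Gamma> (\<lambda>x. \<psi> x y)) \<and>
     (\<forall>x y. x \<notin> HV \<Gamma> \<or> y \<notin> HV \<Gamma> \<longrightarrow> \<psi> x y = 0)"

definition C2 :: "complex set \<Rightarrow> (hv \<Rightarrow> hv \<Rightarrow> complex) set" where
  "C2 \<Gamma> = {\<psi>. bilinear_form_HV \<Gamma> \<psi> \<and>
     (\<forall>x\<in>HV \<Gamma>. \<forall>y\<in>HV \<Gamma>. \<psi> x y = - \<psi> y x) \<and>
     (\<forall>x\<in>HV \<Gamma>. \<forall>y\<in>HV \<Gamma>. \<forall>z\<in>HV \<Gamma>.
        \<psi> x (bracket y z) + \<psi> y (bracket z x) + \<psi> z (bracket x y) = 0)}"

definition coboundary :: "complex set \<Rightarrow> (hv \<Rightarrow> complex) \<Rightarrow> hv \<Rightarrow> hv \<Rightarrow> complex" where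
  "coboundary \<Gamma> f x y = (if x \<in> HV \<Gamma> \<and> y \<in> HV \<Gamma> then f (bracket x y) else 0)"

definition B2 :: "complex set \<Rightarrow> (hv \<Rightarrow> hv \<Rightarrow> complex) set" where
  "B2 \<Gamma> = {coboundary \<Gamma> f | f. linear_on_HV \<Gamma> f}"

definition cohomologous :: "complex set \<Rightarrow> ((hv \<Rightarrow> hv \<Rightarrow> complex) \<times> (hv \<Rightarrow> hv \<Rightarrow> complex)) set" where
  "cohomologous \<Gamma> =
     {(\<psi>, \<phi>). \<psi> \<in> C2 \<Gamma> \<and> \<phi> \<in> C2 \<Gamma> \<and> (\<lambda>x y. \<psi> x y - \<phi> x y) \<in> B2 \<Gamma>}"

lemma B2_subset_C2:
  assumes "complex_subgroup \<Gamma>"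
  shows "B2 \<Gamma> \<subseteq> C2 \<Gamma>"
proof
  fix \<psi> assume "\<psi> \<in> B2 \<Gamma>"
  then obtain f where f: "linear_on_HV \<Gamma> f" and \<psi>: "\<psi> = coboundary \<Gamma> f"
    by (auto simp: B2_def)
  note closed = bracket_in_HV[OF assms] hv.subspace_add[OF subspace_HV]
    hv.subspace_scale[OF subspace_HV] hv.subspace_neg[OF subspace_HV]
  have add: "f (x + y) = f x + f y" if "x \<in> HV \<Gamma>" "y \<in> HV \<Gamma>" for x y
    using f that by (auto simp: linear_on_HV_def)
  have scale: "f (scale_hv c x) = c * f x" if "x \<in> HV \<Gamma>" for c x
    using f that by (auto simp: linear_on_HV_def)
  have neg: "f (- x) = - f x" if "x \<in> HV \<Gamma>" for x
    using scale[of x "-1"] that by simp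
  have zero: "f 0 = 0"
    using scale[of 0 0] hv.subspace_0[OF subspace_HV] by simp
  have "\<psi> x y = - \<psi> y x" if "x \<in> HV \<Gamma>" "y \<in> HV \<Gamma>" for x y
    using that bracket_skew[of x y] by (simp add: \<psi> coboundary_def neg closed)
  moreover have "bilinear_form_HV \<Gamma> \<psi>"
    unfolding bilinear_form_HV_def linear_on_HV_def \<psi> coboundary_def
    by (auto simp: closed add scale bracket_add_left bracket_add_right
        bracket_scale_left bracket_scale_right)
  moreover have "\<psi> x (bracket y z) + \<psi> y (bracket z x) + \<psi> z (bracket x y) = 0"
    if "x \<in> HV \<Gamma>" "y \<in> HV \<Gamma>" "z \<in> HV \<Gamma>" for x y z
  proof -
    have "\<psi> x (bracket y z) + \<psi> y (bracket z x) + \<psi> z (bracket x y) = f (jacobiator x y z)"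
      using that by (simp add: \<psi> coboundary_def closed jacobiator_def add)
    then show ?thesis by (simp add: jacobiator_eq_0 zero)
  qed
  ultimately show "\<psi> \<in> C2 \<Gamma>" unfolding C2_def by blast
qed

lemma equiv_cohomologous:
  assumes "complex_subgroup \<Gamma>"
  shows "equiv (C2 \<Gamma>) (cohomologous \<Gamma>)"
proof (rule equivI)
  show "cohomologous \<Gamma> \<subseteq> C2 \<Gamma> \<times> C2 \<Gamma>"
    by (auto simp: cohomologous_def)
  have "(\<lambda>x y. 0) = coboundary \<Gamma> (\<lambda>x. 0)" "linear_on_HV \<Gamma> (\<lambda>x. 0)"
    by (auto simp: coboundary_def linear_on_HV_def fun_eq_iff)
  then have "(\<lambda>x y. 0) \<in> B2 \<Gamma>"
    unfolding B2_def by blast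
  then show "refl_on (C2 \<Gamma>) (cohomologous \<Gamma>)"
    by (auto simp: refl_on_def cohomologous_def)
  show "sym (cohomologous \<Gamma>)"
  proof (rule symI)
    fix \<psi> \<phi> assume *: "(\<psi>, \<phi>) \<in> cohomologous \<Gamma>"
    then obtain f where f: "linear_on_HV \<Gamma> f" "(\<lambda>x y. \<psi> x y - \<phi> x y) = coboundary \<Gamma> f"
      by (auto simp: cohomologous_def B2_def)
    have "linear_on_HV \<Gamma> (\<lambda>x. - f x)"
      using f(1) by (auto simp: linear_on_HV_def)
    moreover have "(\<lambda>x y. \<phi> x y - \<psi> x y) = coboundary \<Gamma> (\<lambda>x. - f x)"
    proof (intro ext)
      fix x y
      show "\<phi> x y - \<psi> x y = coboundary \<Gamma> (\<lambda>x. - f x) x y"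
        using fun_cong[OF fun_cong[OF f(2)], of x y]
        by (auto simp: coboundary_def algebra_simps split: if_splits)
    qed
    ultimately show "(\<phi>, \<psi>) \<in> cohomologous \<Gamma>"
      using * by (auto simp: cohomologous_def B2_def)
  qed
  show "trans (cohomologous \<Gamma>)"
  proof (rule transI)
    fix \<psi> \<phi> \<chi> assume *: "(\<psi>, \<phi>) \<in> cohomologous \<Gamma>" "(\<phi>, \<chi>) \<in> cohomologous \<Gamma>"
    then obtain f g where f: "linear_on_HV \<Gamma> f" "(\<lambda>x y. \<psi> x y - \<phi> x y) = coboundary \<Gamma> f"
      and g: "linear_on_HV \<Gamma> g" "(\<lambda>x y. \<phi> x y - \<chi> x y) = coboundary \<Gamma> g"
      by (auto simp: cohomologous_def B2_def)
    have "linear_on_HV \<Gamma> (\<lambda>x. f x + g x)"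
      using f(1) g(1) by (auto simp: linear_on_HV_def algebra_simps)
    moreover have "(\<lambda>x y. \<psi> x y - \<chi> x y) = coboundary \<Gamma> (\<lambda>x. f x + g x)"
    proof (intro ext)
      fix x y
      show "\<psi> x y - \<chi> x y = coboundary \<Gamma> (\<lambda>x. f x + g x) x y"
        using fun_cong[OF fun_cong[OF f(2)], of x y] fun_cong[OF fun_cong[OF g(2)], of x y]
        by (auto simp: coboundary_def algebra_simps split: if_splits)
    qed
    ultimately show "(\<psi>, \<chi>) \<in> cohomologous \<Gamma>"
      using * by (auto simp: cohomologous_def B2_def)
  qed
qed

definition H2 :: "complex set \<Rightarrow> (hv \<Rightarrow> hv \<Rightarrow> complex) set set" where
  "H2 \<Gamma> = C2 \<Gamma> // cohomologous \<Gamma>"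

definition H2_zero :: "complex set \<Rightarrow> (hv \<Rightarrow> hv \<Rightarrow> complex) set" where
  "H2_zero \<Gamma> = cohomologous \<Gamma> `` {\<lambda>x y. 0}"

end

(* The operator D = [L_{0,0}, _] acts on each family X in {L, H} by
     D X_{a,i} = a X_{a,i} + i X_{a,i-1},
   that is, like d/dt on e^{a t} t^i; it is surjective with kernel spanned by L_{0,0} and H_{0,0}.
   As H_{0,0} is central and L_{0,0} is a bracket, a cocycle psi vanishes on (L_{0,0}, H_{0,0}), so
   f (D x) = psi (L_{0,0}, x) is solvable for f, and psi - psi_f is a cocycle annihilated by
   L_{0,0}.  Such a cocycle is D-invariant, and a D-invariant bilinear form is zero: in
     (a + b) phi(i, j) + i phi(i-1, j) + j phi(i, j-1) = 0
   one inducts on i + j if a + b is nonzero, and on j if a + b = 0. *)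
theory Submission
  imports Defs
begin

section \<open>Linear and bilinear forms determined by their values on the basis\<close>

lemma linear_on_HV_eq_0:
  assumes "linear_on_HV \<Gamma> f" "\<And>k. k \<in> HV_basis \<Gamma> \<Longrightarrow> f (Poly_Mapping.single k 1) = 0" "x \<in> HV \<Gamma>"
  shows "f x = 0"
proof -
  note sub = subspace_HV[of \<Gamma>]
  have "f (scale_hv 0 0) = 0 * f 0"
    using assms(1) hv.subspace_0[OF sub] unfolding linear_on_HV_def by blast
  then have "f 0 = 0" by simp
  then have "hv.subspace {x \<in> HV \<Gamma>. f x = 0}"
    using assms(1) sub unfolding hv.subspace_def linear_on_HV_def by auto
  then have "hv.span ((\<lambda>k. Poly_Mapping.single k 1) ` HV_basis \<Gamma>) \<subseteq> {x \<in> HV \<Gamma>. f x = 0}"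
    using assms(2) by (intro hv.span_minimal) (auto simp: HV_def)
  then show ?thesis using assms(3) unfolding HV_eq_span[symmetric] by blast
qed

text \<open>Linearity in one argument at a time reduces the claim to pairs of basis vectors.
  Arguments outside \<open>HV \<Gamma>\<close> are covered by the convention that forms vanish
  there, so the form is zero as a function.\<close>

lemma bilinear_form_HV_eq_0:
  assumes "bilinear_form_HV \<Gamma> \<phi>"
    and "\<And>k l. k \<in> HV_basis \<Gamma> \<Longrightarrow> l \<in> HV_basis \<Gamma> \<Longrightarrow>
      \<phi> (Poly_Mapping.single k 1) (Poly_Mapping.single l 1) = 0"
  shows "\<phi> x y = 0"
proof (cases "x \<in> HV \<Gamma> \<and> y \<in> HV \<Gamma>")
  case True
  have lin: "linear_on_HV \<Gamma> (\<lambda>y. \<phi> x y)" "linear_on_HV \<Gamma> (\<lambda>x. \<phi> x y)"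
    if "x \<in> HV \<Gamma>" "y \<in> HV \<Gamma>" for x y
    using assms(1) that by (auto simp: bilinear_form_HV_def)
  have single: "Poly_Mapping.single k 1 \<in> HV \<Gamma>" if "k \<in> HV_basis \<Gamma>" for k
    using that by (simp add: HV_def)
  have "\<phi> (Poly_Mapping.single k 1) y = 0" if "k \<in> HV_basis \<Gamma>" for k
    by (rule linear_on_HV_eq_0[OF lin(1)]) (use that assms(2) single True in auto)
  then show ?thesis
    by (intro linear_on_HV_eq_0[OF lin(2), of x y x]) (use True in auto)
next
  case False
  then show ?thesis using assms(1) by (auto simp: bilinear_form_HV_def)
qed

text \<open>Taken on the whole free space rather than on \<open>HV \<Gamma>\<close>, so that
  additivity and homogeneity hold without membership conditions.\<close>

definition linear_extension :: "(hv_index \<Rightarrow> complex) \<Rightarrow> hv \<Rightarrow> complex" where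
  "linear_extension g x = (\<Sum>k\<in>Poly_Mapping.keys x. Poly_Mapping.lookup x k * g k)"

lemma linear_extension_superset:
  assumes "finite A" "Poly_Mapping.keys x \<subseteq> A"
  shows "linear_extension g x = (\<Sum>k\<in>A. Poly_Mapping.lookup x k * g k)"
  unfolding linear_extension_def using assms
  by (intro sum.mono_neutral_left) (auto simp: in_keys_iff)

lemma linear_extension_single [simp]: "linear_extension g (Poly_Mapping.single k c) = c * g k"
  by (subst linear_extension_superset[of "{k}"]) (auto simp: keys_single)

lemma linear_extension_add: "linear_extension g (x + y) = linear_extension g x + linear_extension g y"
proof -
  let ?A = "Poly_Mapping.keys x \<union> Poly_Mapping.keys y"
  have "Poly_Mapping.keys (x + y) \<subseteq> ?A" by (rule keys_add)
  then show ?thesis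
    by (simp add: linear_extension_superset[of ?A] lookup_add distrib_right sum.distrib)
qed

lemma linear_extension_scale: "linear_extension g (scale_hv c x) = c * linear_extension g x"
  using keys_scale_hv[of c x]
  by (simp add: linear_extension_superset[of "Poly_Mapping.keys x"] sum_distrib_left mult.assoc)

lemma linear_on_HV_linear_extension: "linear_on_HV \<Gamma> (linear_extension g)"
  by (simp add: linear_on_HV_def linear_extension_add linear_extension_scale)

section \<open>The operator D and its two recursions\<close>

text \<open>The variable \<open>X\<close> ranges over the two constructors, so that both families
  are treated at once. The truncation in \<open>j - 1\<close> is harmless: at j = 0 its coefficient
  is 0.\<close>

lemma bracket_L00:
  assumes "X \<in> {L_idx, H_idx}"
  shows "bracket (Poly_Mapping.single (L_idx 0 0) 1) (Poly_Mapping.single (X \<beta> j) 1) =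
    scale_hv \<beta> (Poly_Mapping.single (X \<beta> j) 1) +
    scale_hv (of_nat j) (Poly_Mapping.single (X \<beta> (j - 1)) 1)"
  using assms by (auto simp: bracket_L_L bracket_L_H)

text \<open>Solvability of D f = s on one family of fixed weight \<beta>. The only obstruction is
  the equation j = 0 when \<beta> = 0, whose left side vanishes.\<close>

lemma ex_primitive:
  fixes \<beta> :: complex and s :: "nat \<Rightarrow> complex"
  assumes "\<beta> = 0 \<Longrightarrow> s 0 = 0"
  shows "\<exists>u. \<forall>j. \<beta> * u j + of_nat j * u (j - 1) = s j"
proof (cases "\<beta> = 0")
  case True
  \<comment> \<open>With \<beta> = 0 the equation at j + 1 determines u j by division.\<close>
  have "of_nat j * (s (Suc (j - 1)) / of_nat (Suc (j - 1))) = s j" for j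
    using assms True by (cases j) (auto simp del: of_nat_Suc)
  then show ?thesis
    using True by (intro exI[of _ "\<lambda>j. s (Suc j) / of_nat (Suc j)"]) simp
next
  case False
  \<comment> \<open>With \<beta> nonzero the equation at j determines u j from u (j - 1).\<close>
  define u where "u = rec_nat (s 0 / \<beta>) (\<lambda>j v. (s (Suc j) - of_nat (Suc j) * v) / \<beta>)"
  have "\<beta> * u j + of_nat j * u (j - 1) = s j" for j
    using False by (cases j) (auto simp: u_def)
  then show ?thesis by blast
qed

text \<open>The number \<open>c\<close> is \<open>\<alpha> + \<beta>\<close> for the weights \<open>\<alpha>, \<beta>\<close> of the two arguments of an invariant form.\<close>

lemma invariant_recursion_eq_0:
  fixes p :: "nat \<Rightarrow> nat \<Rightarrow> complex"
  assumes rec: "\<And>i j. c * p i j + of_nat i * p (i - 1) j + of_nat j * p i (j - 1) = 0"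
  shows "p i j = 0"
proof (cases "c = 0")
  case True
  have "p i j = 0" for i
  proof (induction j arbitrary: i)
    case 0
    \<comment> \<open>Raising the first index makes \<open>p i 0\<close> the only surviving term,
      with nonzero coefficient i + 1.\<close>
    show ?case using rec[of "Suc i" 0] True by (simp del: of_nat_Suc)
  next
    case (Suc j)
    \<comment> \<open>The other term contains \<open>p (Suc i) j\<close>: hence the induction
      hypothesis for all first indices.\<close>
    show ?case using rec[of "Suc i" "Suc j"] True Suc by (simp del: of_nat_Suc)
  qed
  then show ?thesis .
next
  case False
  show ?thesis
  proof (induction "i + j" arbitrary: i j rule: less_induct)
    case less
    \<comment> \<open>At i = 0 the index sum does not drop, but the factor is 0.\<close>
    have "of_nat i * p (i - 1) j = 0"
      using less[of "i - 1" j] by (cases i) auto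
    moreover have "of_nat j * p i (j - 1) = 0"
      using less[of i "j - 1"] by (cases j) auto
    ultimately show ?case using rec[of i j] False by (simp del: mult_eq_0_iff) simp
  qed
qed

section \<open>Cocycles and their values on \<open>L_idx 0 0\<close>\<close>

lemma C2D:
  assumes "\<psi> \<in> C2 \<Gamma>"
  shows "bilinear_form_HV \<Gamma> \<psi>"
    and "x \<in> HV \<Gamma> \<Longrightarrow> y \<in> HV \<Gamma> \<Longrightarrow> \<psi> x y = - \<psi> y x"
    and "x \<in> HV \<Gamma> \<Longrightarrow> y \<in> HV \<Gamma> \<Longrightarrow> z \<in> HV \<Gamma> \<Longrightarrow>
      \<psi> x (bracket y z) + \<psi> y (bracket z x) + \<psi> z (bracket x y) = 0"
  using assms unfolding C2_def by blast+

lemma cocycle_eq_0: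
  assumes \<Gamma>: "complex_subgroup \<Gamma>" and \<phi>: "\<phi> \<in> C2 \<Gamma>"
    and ann: "\<And>x. x \<in> HV \<Gamma> \<Longrightarrow> \<phi> (Poly_Mapping.single (L_idx 0 0) 1) x = 0"
  shows "\<phi> x y = 0"
proof (rule bilinear_form_HV_eq_0)
  show bil: "bilinear_form_HV \<Gamma> \<phi>" by (rule C2D(1)[OF \<phi>])
  define e :: "hv_index \<Rightarrow> hv" where "e k = Poly_Mapping.single k 1" for k
  let ?D = "bracket (e (L_idx 0 0))"
  note closed = bracket_in_HV[OF \<Gamma>] hv.subspace_add[OF subspace_HV]
    hv.subspace_scale[OF subspace_HV] hv.subspace_neg[OF subspace_HV]
  have e: "e k \<in> HV \<Gamma>" if "k \<in> HV_basis \<Gamma>" for k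
    using that by (simp add: HV_def e_def)
  have e0: "e (L_idx 0 0) \<in> HV \<Gamma>"
    using \<Gamma> by (intro e) (auto simp: HV_basis_def complex_subgroup_def)
  have add: "\<phi> (x + x') y = \<phi> x y + \<phi> x' y" "\<phi> y (x + x') = \<phi> y x + \<phi> y x'"
    if "x \<in> HV \<Gamma>" "x' \<in> HV \<Gamma>" "y \<in> HV \<Gamma>" for x x' y
    using bil that by (auto simp: bilinear_form_HV_def linear_on_HV_def)
  have scale: "\<phi> (scale_hv c x) y = c * \<phi> x y" "\<phi> y (scale_hv c x) = c * \<phi> y x"
    if "x \<in> HV \<Gamma>" "y \<in> HV \<Gamma>" for x y c
    using bil that by (auto simp: bilinear_form_HV_def linear_on_HV_def)
  have inv: "\<phi> (?D x) y + \<phi> x (?D y) = 0" if "x \<in> HV \<Gamma>" "y \<in> HV \<Gamma>" for x y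
  proof -
    \<comment> \<open>The cocycle identity with L_{0,0} as first entry. Its first term vanishes by
      \<open>ann\<close>, and skew-symmetry turns the other two into D-invariance.\<close>
    have "\<phi> (e (L_idx 0 0)) (bracket x y) + \<phi> x (bracket y (e (L_idx 0 0))) + \<phi> y (?D x) = 0"
      by (rule C2D(3)[OF \<phi> e0 that])
    moreover have "\<phi> x (bracket y (e (L_idx 0 0))) = - \<phi> x (?D y)"
      using scale(2)[of "?D y" x "-1"] that e0 closed bracket_skew[of y "e (L_idx 0 0)"] by simp
    moreover have "\<phi> y (?D x) = - \<phi> (?D x) y"
      using that by (intro C2D(2)[OF \<phi>] closed e0)
    moreover have "\<phi> (e (L_idx 0 0)) (bracket x y) = 0"
      using ann that closed by (simp add: e_def)
    ultimately show ?thesis by (simp add: add_eq_0_iff2)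
  qed
  have zero: "\<phi> (e (X \<alpha> i)) (e (Y \<beta> j)) = 0"
    if XY: "X \<in> {L_idx, H_idx}" "Y \<in> {L_idx, H_idx}" and "\<alpha> \<in> \<Gamma>" "\<beta> \<in> \<Gamma>" for X Y \<alpha> \<beta> i j
  proof (rule invariant_recursion_eq_0[where c = "\<alpha> + \<beta>"])
    fix i j
    have mem: "e (X \<alpha> i) \<in> HV \<Gamma>" "e (Y \<beta> j) \<in> HV \<Gamma>" for i j
      using that by (auto intro!: e simp: HV_basis_def)
    show "(\<alpha> + \<beta>) * \<phi> (e (X \<alpha> i)) (e (Y \<beta> j)) + of_nat i * \<phi> (e (X \<alpha> (i - 1))) (e (Y \<beta> j)) +
        of_nat j * \<phi> (e (X \<alpha> i)) (e (Y \<beta> (j - 1))) = 0"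
      \<comment> \<open>Expanding both occurrences of D in the invariance gives the recursion; the
        weights add up to \<alpha> + \<beta>.\<close>
      using inv[OF mem, of i j] bracket_L00[OF XY(1), of \<alpha> i] bracket_L00[OF XY(2), of \<beta> j]
      unfolding e_def[symmetric]
      by (simp add: add scale mem closed algebra_simps)
  qed
  show "\<phi> (Poly_Mapping.single k 1) (Poly_Mapping.single l 1) = 0"
    if "k \<in> HV_basis \<Gamma>" "l \<in> HV_basis \<Gamma>" for k l
    using that zero unfolding HV_basis_def e_def by auto
qed

lemma cocycle_L00_H00:
  assumes "complex_subgroup \<Gamma>" "\<psi> \<in> C2 \<Gamma>"
  shows "\<psi> (Poly_Mapping.single (L_idx 0 0) 1) (Poly_Mapping.single (H_idx 0 0) 1) = 0"
proof -
  let ?L = "\<lambda>i. Poly_Mapping.single (L_idx 0 i) (1::complex)"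
  let ?H = "Poly_Mapping.single (H_idx 0 0) (1::complex)"
  have mem: "?L i \<in> HV \<Gamma>" "?H \<in> HV \<Gamma>" for i
    using assms(1) by (auto simp: HV_def HV_basis_def complex_subgroup_def)
  have [simp]: "\<psi> x 0 = 0" if "x \<in> HV \<Gamma>" for x
  proof -
    have "linear_on_HV \<Gamma> (\<psi> x)"
      using C2D(1)[OF assms(2)] that by (simp add: bilinear_form_HV_def)
    then have "\<psi> x (scale_hv 0 0) = 0 * \<psi> x 0"
      using hv.subspace_0[OF subspace_HV] unfolding linear_on_HV_def by blast
    then show ?thesis by simp
  qed
  \<comment> \<open>L_{0,1} serves because [L_{0,0}, L_{0,1}] = L_{0,0}, while H_{0,0} commutes with
    both: only \<psi>(H_{0,0}, L_{0,0}) remains.\<close>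
  have "\<psi> ?H (bracket (?L 0) (?L 1)) + \<psi> (?L 0) (bracket (?L 1) ?H) + \<psi> (?L 1) (bracket ?H (?L 0)) = 0"
    by (rule C2D(3)[OF assms(2) mem(2,1,1)])
  moreover have "bracket (?L 0) (?L 1) = ?L 0" "bracket (?L 1) ?H = 0" "bracket ?H (?L 0) = 0"
    by (simp_all add: bracket_single)
  ultimately have "\<psi> ?H (?L 0) = 0" using mem by simp
  moreover have "\<psi> (?L 0) ?H = - \<psi> ?H (?L 0)"
    by (rule C2D(2)[OF assms(2) mem])
  ultimately show ?thesis by simp
qed

lemma C2_diff:
  assumes "\<psi> \<in> C2 \<Gamma>" "\<chi> \<in> C2 \<Gamma>"
  shows "(\<lambda>x y. \<psi> x y - \<chi> x y) \<in> C2 \<Gamma>"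
proof -
  have "bilinear_form_HV \<Gamma> (\<lambda>x y. \<psi> x y - \<chi> x y)"
    using C2D(1)[OF assms(1)] C2D(1)[OF assms(2)]
    by (auto simp: bilinear_form_HV_def linear_on_HV_def algebra_simps)
  moreover have "\<psi> x y - \<chi> x y = - (\<psi> y x - \<chi> y x)" if "x \<in> HV \<Gamma>" "y \<in> HV \<Gamma>" for x y
  proof -
    show ?thesis
      using C2D(2)[OF assms(1) that] C2D(2)[OF assms(2) that] by simp
  qed
  moreover have "(\<psi> x (bracket y z) - \<chi> x (bracket y z)) + (\<psi> y (bracket z x) - \<chi> y (bracket z x)) +
      (\<psi> z (bracket x y) - \<chi> z (bracket x y)) = 0"
    if "x \<in> HV \<Gamma>" "y \<in> HV \<Gamma>" "z \<in> HV \<Gamma>" for x y z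
  proof -
    show ?thesis
      using C2D(3)[OF assms(1) that] C2D(3)[OF assms(2) that] by algebra
  qed
  ultimately show ?thesis unfolding C2_def by blast
qed

section \<open>Every cocycle is a coboundary\<close>

lemma C2_subset_B2:
  assumes \<Gamma>: "complex_subgroup \<Gamma>"
  shows "C2 \<Gamma> \<subseteq> B2 \<Gamma>"
proof
  fix \<psi> assume \<psi>: "\<psi> \<in> C2 \<Gamma>"
  define e :: "hv_index \<Rightarrow> hv" where "e k = Poly_Mapping.single k 1" for k
  let ?L = "e (L_idx 0 0)"
  have L: "?L \<in> HV \<Gamma>"
    using \<Gamma> by (auto simp: e_def HV_def HV_basis_def complex_subgroup_def)
  \<comment> \<open>Together with \<open>cocycle_L00_H00\<close> this gives the solvability
    condition of \<open>ex_primitive\<close> at weight 0 for both families.\<close>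
  have "\<psi> ?L ?L = - \<psi> ?L ?L"
    by (rule C2D(2)[OF \<psi> L L])
  then have "\<psi> ?L (e (X 0 0)) = 0" if "X \<in> {L_idx, H_idx}" for X
    using cocycle_L00_H00[OF \<Gamma> \<psi>] that by (auto simp: e_def)
  then have "\<exists>u. \<forall>j. \<beta> * u j + of_nat j * u (j - 1) = \<psi> ?L (e (X \<beta> j))"
    if "X \<in> {L_idx, H_idx}" for X \<beta>
    using ex_primitive[of \<beta> "\<lambda>j. \<psi> ?L (e (X \<beta> j))"] that by blast
  \<comment> \<open>Moving the condition on \<open>X\<close> below the existential quantifier allows
    choosing one solution for each \<open>X\<close> and \<beta>.\<close>
  then have "\<forall>X. \<forall>\<beta>. \<exists>u. X \<in> {L_idx, H_idx} \<longrightarrow>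
      (\<forall>j. \<beta> * u j + of_nat j * u (j - 1) = \<psi> ?L (e (X \<beta> j)))"
    by blast
  then obtain u where u: "\<beta> * u X \<beta> j + of_nat j * u X \<beta> (j - 1) = \<psi> ?L (e (X \<beta> j))"
    if "X \<in> {L_idx, H_idx}" for X \<beta> j
    unfolding choice_iff by blast
  define f where
    "f = linear_extension (\<lambda>k. case k of L_idx \<beta> j \<Rightarrow> u L_idx \<beta> j | H_idx \<beta> j \<Rightarrow> u H_idx \<beta> j)"
  have f: "linear_on_HV \<Gamma> f"
    unfolding f_def by (rule linear_on_HV_linear_extension)
  define \<phi> where "\<phi> x y = \<psi> x y - coboundary \<Gamma> f x y" for x y
  have "coboundary \<Gamma> f \<in> C2 \<Gamma>"
    using B2_subset_C2[OF \<Gamma>] f by (auto simp: B2_def)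
  then have \<phi>: "\<phi> \<in> C2 \<Gamma>"
    using C2_diff[OF \<psi>] unfolding \<phi>_def[abs_def] by blast
  have "\<phi> ?L x = 0" if "x \<in> HV \<Gamma>" for x
  proof (rule linear_on_HV_eq_0[OF _ _ that])
    show "linear_on_HV \<Gamma> (\<phi> ?L)"
      using C2D(1)[OF \<phi>] L by (simp add: bilinear_form_HV_def)
    fix k assume k: "k \<in> HV_basis \<Gamma>"
    then obtain X \<beta> j where X: "X \<in> {L_idx, H_idx}" and k_eq: "k = X \<beta> j"
      by (auto simp: HV_basis_def)
    have "e k \<in> HV \<Gamma>" using k by (simp add: e_def HV_def)
    then have "coboundary \<Gamma> f ?L (e k) = f (bracket ?L (e k))"
      using L by (simp add: coboundary_def)
    also have "\<dots> = \<beta> * f (e k) + of_nat j * f (e (X \<beta> (j - 1)))"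
      unfolding e_def k_eq bracket_L00[OF X]
      by (simp only: f_def linear_extension_add linear_extension_scale)
    also have "\<dots> = \<psi> ?L (e k)"
      using X u[OF X, of \<beta> j] by (auto simp: f_def e_def k_eq)
    finally show "\<phi> ?L (Poly_Mapping.single k 1) = 0"
      by (simp add: \<phi>_def e_def)
  qed
  then have "\<phi> x y = 0" for x y
    unfolding e_def by (rule cocycle_eq_0[OF \<Gamma> \<phi>])
  then have "\<psi> = coboundary \<Gamma> f"
    by (simp add: fun_eq_iff \<phi>_def)
  then show "\<psi> \<in> B2 \<Gamma>" using f by (auto simp: B2_def)
qed

theorem theorem5p1:
  fixes \<Gamma> :: "complex set"
  assumes "complex_subgroup \<Gamma>" and "\<Gamma> \<noteq> {0}"
  shows "H2 \<Gamma> = {H2_zero \<Gamma>}"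
proof -
  note eq = equiv_cohomologous[OF assms(1)]
  have zero: "(\<lambda>x y. 0) \<in> C2 \<Gamma>"
    by (simp add: C2_def bilinear_form_HV_def linear_on_HV_def)
  \<comment> \<open>The difference of \<psi> and the zero cocycle is \<psi> itself, which is a
    coboundary.\<close>
  have "cohomologous \<Gamma> `` {\<psi>} = H2_zero \<Gamma>" if "\<psi> \<in> C2 \<Gamma>" for \<psi>
    unfolding H2_zero_def
    by (rule equiv_class_eq[OF eq])
       (use that zero C2_subset_B2[OF assms(1)] in \<open>auto simp: cohomologous_def\<close>)
  \<comment> \<open>The zero cocycle makes the quotient nonempty, so it is exactly one
    class.\<close>
  then show ?thesis
    unfolding H2_def quotient_def using zero by auto
qed

end
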